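(* Fix a probability distribution supported on the non-negative reals with finite first moment $\mu_1>0$ and finite second moment $\mu_2$. For each positive integer $n$ let $\mathbf A$ be a random matrix of size $n\times n$ whose entries are i.i.d. according to this distribution. Then, as $n\to\infty$, $$\frac{\sqrt{\mathbb E\bigl[\mathrm{perm}(\mathbf A)^2\bigr]}}{\sqrt{\mathbb E\bigl[\mathrm{perm}_{\mathrm B,2}(\mathbf A)^2\bigr]}}\sim\sqrt[4]{\frac{\pi n}{\mathrm e}}.$$
   Context: Notation: $[n]=\{1,\dots,n\}$; $\mathcal S_n$ is the group of permutations of $[n]$; $\mathrm{perm}(\mathbf B)=\sum_{\sigma\in\mathcal S_m}\prod_{i\in[m]}b_{i,\sigma(i)}$ for an $m\times m$ matrix $\mathbf B$; $a(n)\sim b(n)$ means $\lim_{n\to\infty}a(n)/b(n)=1$; $\mathrm e$ is Euler's number. Degree-$M$ Bethe permanent of a non-negative matrix $\mathbf A=(a_{i,j})\in\mathbb R^{n\times n}$: for a positive integer $M$, let $\tilde\Phi_M$ be the set of all families $\tilde{\mathbf P}=\{\tilde{\mathbf P}^{(i,j)}\}_{i,j\in[n]}$ of $M\times M$ permutation matrices (so $|\tilde\Phi_M|=(M!)^{n^2}$). For $\tilde{\mathbf P}\in\tilde\Phi_M$ let $\mathbf A^{\uparrow\tilde{\mathbf P}}$ be the $(Mn)\times(Mn)$ block matrix whose $(i,j)$ block is $a_{i,j}\tilde{\mathbf P}^{(i,j)}$. Then $$\mathrm{perm}_{\mathrm{B},M}(\mathbf A)=\Bigl(\frac{1}{|\tilde\Phi_M|}\sum_{\tilde{\mathbf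 P}\in\tilde\Phi_M}\mathrm{perm}(\mathbf A^{\uparrow\tilde{\mathbf P}})\Bigr)^{1/M}.$$ *)

theory Defs
  imports "HOL-Probability.Probability" "HOL-Library.Landau_Symbols" "Jordan_Normal_Form.Matrix"
begin

definition permanent :: "'a :: comm_semiring_1 mat \<Rightarrow> 'a" where
  "permanent B = (\<Sum>\<sigma> | \<sigma> permutes {0..<dim_row B}. \<Prod>i = 0..<dim_row B. B $$ (i, \<sigma> i))"

definition permutation_mats :: "nat \<Rightarrow> real mat set" where
  "permutation_mats M =
     {mat M M (\<lambda>(r, c). if \<sigma> r = c then 1 else 0) | \<sigma>. \<sigma> permutes {0..<M}}"

definition lift_families :: "nat \<Rightarrow> nat \<Rightarrow> (nat \<times> nat \<Rightarrow> real mat) set" where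
  "lift_families n M = ({0..<n} \<times> {0..<n}) \<rightarrow>\<^sub>E permutation_mats M"

text \<open>With 0-based indices, row \<open>r\<close> of the lifted matrix is row \<open>r mod M\<close> inside the
  block row \<open>r div M\<close>, and likewise for columns.\<close>

definition lifted_mat :: "nat \<Rightarrow> real mat \<Rightarrow> (nat \<times> nat \<Rightarrow> real mat) \<Rightarrow> real mat" where
  "lifted_mat M A P = mat (M * dim_row A) (M * dim_col A)
     (\<lambda>(r, c). A $$ (r div M, c div M) * P (r div M, c div M) $$ (r mod M, c mod M))"

definition bethe_permanent :: "nat \<Rightarrow> real mat \<Rightarrow> real" where
  "bethe_permanent M A =
     root M ((\<Sum>P \<in> lift_families (dim_row A) M. permanent (lifted_mat M A P))
             / real (card (lift_families (dim_row A) M)))"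

definition iid_random_matrix ::
  "'w measure \<Rightarrow> real measure \<Rightarrow> nat \<Rightarrow> ('w \<Rightarrow> real mat) \<Rightarrow> bool" where
  "iid_random_matrix \<Omega> D n A \<longleftrightarrow>
     prob_space \<Omega> \<and>
     (\<forall>\<omega> \<in> space \<Omega>. A \<omega> \<in> carrier_mat n n) \<and>
     prob_space.indep_vars \<Omega> (\<lambda>_. borel) (\<lambda>ij \<omega>. A \<omega> $$ ij) ({0..<n} \<times> {0..<n}) \<and>
     (\<forall>ij \<in> {0..<n} \<times> {0..<n}. distr \<Omega> borel (\<lambda>\<omega>. A \<omega> $$ ij) = D)"

end

theory Submission
  imports Defs
begin

text \<open>
  Averaging over the lifts as well as over the matrix turns
  \<open>\<bbbE>[perm\<^sub>B\<^sub>,\<^sub>2(A)\<^sup>2]\<close> into a sum over the permutations \<open>\<sigma>\<close> of \<open>2n\<close> points, grouped in \<open>n\<close> pairs: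
  a pair of rows that \<open>\<sigma>\<close> sends to a single pair of columns contributes \<open>\<mu>\<^sub>2/2\<close>, any other pair
  of rows contributes \<open>\<mu>\<^sub>1\<^sup>2/4\<close>. In the same way \<open>\<bbbE>[perm(A)\<^sup>2]\<close> is a sum over pairs of permutations
  of \<open>n\<close> points, weighted by their agreements. With \<open>r = \<mu>\<^sub>2/\<mu>\<^sub>1\<^sup>2\<close>, inclusion-exclusion evaluates both:
  dividing by \<open>\<mu>\<^sub>1\<^sup>2\<^sup>n (n!)\<^sup>2\<close> leaves the coefficient of \<open>x\<^sup>n\<close> in \<open>exp((r - 1) x) / (1 - x)\<close> for the permanent
  and in \<open>exp((r - 1/2) x) / sqrt(1 - x)\<close> for the Bethe permanent. The former tends to
  \<open>exp(r - 1)\<close> and the latter is asymptotic to \<open>exp(r - 1/2) / sqrt(\<pi> n)\<close>.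
\<close>

subsection \<open>Counting permutations that preserve pairs\<close>

lemma card_permutes_extending:
  assumes X: "finite X" and Y: "Y \<subseteq> X" and f: "inj_on f Y" "f ` Y \<subseteq> X"
  shows "card {\<sigma>. \<sigma> permutes X \<and> (\<forall>y\<in>Y. \<sigma> y = f y)} = fact (card X - card Y)"
proof -
  have fin: "finite Y" using X Y finite_subset by blast
  have "card (X - Y) = card (X - f ` Y)"
    using X Y f fin by (simp add: card_Diff_subset card_image)
  then obtain g where g: "bij_betw g (X - Y) (X - f ` Y)"
    using X finite_same_card_bij[of "X - Y" "X - f ` Y"] by auto
  define \<pi> where "\<pi> x = (if x \<in> Y then f x else if x \<in> X then g x else x)" for x
  have "bij_betw \<pi> Y (f ` Y)"
    using f(1) by (subst bij_betw_cong[of _ _ f]) (auto simp: \<pi>_def bij_betw_def)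
  moreover have "bij_betw \<pi> (X - Y) (X - f ` Y)"
    using g by (subst bij_betw_cong[of _ _ g]) (auto simp: \<pi>_def)
  ultimately have "bij_betw \<pi> (Y \<union> (X - Y)) (f ` Y \<union> (X - f ` Y))"
    by (rule bij_betw_combine) auto
  then have "bij_betw \<pi> X X"
    using Y f(2) by (simp add: Un_absorb1)
  then have \<pi>: "\<pi> permutes X"
    by (rule bij_imp_permutes) (use Y in \<open>auto simp: \<pi>_def\<close>)
  have "bij_betw (\<lambda>\<tau>. \<pi> \<circ> \<tau>) {\<tau>. \<tau> permutes (X - Y)}
          {\<sigma>. \<sigma> permutes X \<and> (\<forall>y\<in>Y. \<sigma> y = f y)}"
  proof (rule bij_betw_byWitness[where f' = "\<lambda>\<sigma>. inv_into UNIV \<pi> \<circ> \<sigma>"])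
    show "(\<lambda>\<tau>. \<pi> \<circ> \<tau>) ` {\<tau>. \<tau> permutes (X - Y)} \<subseteq> {\<sigma>. \<sigma> permutes X \<and> (\<forall>y\<in>Y. \<sigma> y = f y)}"
    proof safe
      fix \<tau> assume \<tau>: "\<tau> permutes (X - Y)"
      show "(\<pi> \<circ> \<tau>) permutes X"
        by (rule permutes_compose[OF permutes_subset[OF \<tau>] \<pi>]) auto
      show "(\<pi> \<circ> \<tau>) y = f y" if "y \<in> Y" for y
        using that permutes_not_in[OF \<tau>, of y] by (simp add: \<pi>_def)
    qed
    show "(\<lambda>\<sigma>. inv_into UNIV \<pi> \<circ> \<sigma>) ` {\<sigma>. \<sigma> permutes X \<and> (\<forall>y\<in>Y. \<sigma> y = f y)} \<subseteq> {\<tau>. \<tau> permutes (X - Y)}"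
    proof safe
      fix \<sigma> assume \<sigma>: "\<sigma> permutes X" "\<forall>y\<in>Y. \<sigma> y = f y"
      have fix_Y: "(inv_into UNIV \<pi> \<circ> \<sigma>) y = y" if "y \<in> Y" for y
      proof -
        have "\<sigma> y = \<pi> y" using that \<sigma>(2) by (simp add: \<pi>_def)
        then show ?thesis unfolding comp_apply by (simp only: permutes_inverses(2)[OF \<pi>])
      qed
      show "(inv_into UNIV \<pi> \<circ> \<sigma>) permutes (X - Y)"
      proof (rule permutes_superset)
        show "(inv_into UNIV \<pi> \<circ> \<sigma>) permutes X"
          by (rule permutes_compose[OF \<sigma>(1) permutes_inv[OF \<pi>]])
      qed (use fix_Y in blast)
    qed
  qed (simp_all add: o_assoc permutes_inv_o[OF \<pi>])
  from bij_betw_same_card[OF this, symmetric]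
  have "card {\<sigma>. \<sigma> permutes X \<and> (\<forall>y\<in>Y. \<sigma> y = f y)} = card {\<tau>. \<tau> permutes (X - Y)}" .
  also have "\<dots> = fact (card X - card Y)"
    using X Y fin by (simp add: card_permutations[OF refl] card_Diff_subset)
  finally show ?thesis .
qed

lemma sum_card_Pow:
  fixes h :: "nat \<Rightarrow> real"
  assumes "finite I"
  shows "(\<Sum>S\<in>Pow I. h (card S)) = (\<Sum>k\<le>card I. real (card I choose k) * h k)"
proof -
  have "(\<Sum>S\<in>Pow I. h (card S)) = (\<Sum>k\<le>card I. \<Sum>S\<in>{S\<in>Pow I. card S = k}. h (card S))"
    using assms by (intro sum.group[symmetric]) (auto intro: card_mono)
  also have "\<dots> = (\<Sum>k\<le>card I. real (card I choose k) * h k)"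
    using n_subsets[OF assms] by (intro sum.cong) simp_all
  finally show ?thesis .
qed

text \<open>Inclusion-exclusion in weighted form: each factor is written as \<open>1\<close> plus
  \<open>x - 1\<close> or \<open>0\<close>, and the product is expanded over the subsets
  \<open>S\<close> of \<open>I\<close>. Because the number of \<open>\<sigma>\<close> satisfying
  \<open>Q\<close> on all of \<open>S\<close> depends only on \<open>card S\<close>, subsets of
  equal size can be collected.\<close>

lemma sum_prod_if_eq_binomial_sum:
  fixes x :: real
  assumes T: "finite T" and I: "finite I"
    and N: "\<And>S. S \<subseteq> I \<Longrightarrow> card {\<sigma> \<in> T. \<forall>i\<in>S. Q \<sigma> i} = N (card S)"
  shows "(\<Sum>\<sigma>\<in>T. \<Prod>i\<in>I. if Q \<sigma> i then x else 1)
       = (\<Sum>k\<le>card I. real (card I choose k) * ((x - 1) ^ k * real (N k)))"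
proof -
  have "(\<Prod>i\<in>I. if Q \<sigma> i then x else 1)
      = (\<Sum>S\<in>Pow I. if \<forall>i\<in>S. Q \<sigma> i then (x - 1) ^ card S else 0)" for \<sigma>
  proof -
    have "(\<Prod>i\<in>I. if Q \<sigma> i then x else 1) = (\<Prod>i\<in>I. (if Q \<sigma> i then x - 1 else 0) + 1)"
      by (intro prod.cong) auto
    also have "\<dots> = (\<Sum>S\<in>Pow I. \<Prod>i\<in>S. if Q \<sigma> i then x - 1 else 0)"
      by (simp add: prod_add[OF I])
    also have "\<dots> = (\<Sum>S\<in>Pow I. if \<forall>i\<in>S. Q \<sigma> i then (x - 1) ^ card S else 0)"
    proof (intro sum.cong refl)
      fix S assume "S \<in> Pow I"
      then have "finite S" using I finite_subset by blast
      then show "(\<Prod>i\<in>S. if Q \<sigma> i then x - 1 else 0)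
          = (if \<forall>i\<in>S. Q \<sigma> i then (x - 1) ^ card S else 0)"
        by (cases "\<forall>i\<in>S. Q \<sigma> i") (auto intro: prod_zero)
    qed
    finally show ?thesis .
  qed
  then have "(\<Sum>\<sigma>\<in>T. \<Prod>i\<in>I. if Q \<sigma> i then x else 1)
      = (\<Sum>\<sigma>\<in>T. \<Sum>S\<in>Pow I. if \<forall>i\<in>S. Q \<sigma> i then (x - 1) ^ card S else 0)"
    by (simp only:)
  also have "\<dots> = (\<Sum>S\<in>Pow I. \<Sum>\<sigma>\<in>T. if \<forall>i\<in>S. Q \<sigma> i then (x - 1) ^ card S else 0)"
    by (rule sum.swap)
  also have "\<dots> = (\<Sum>S\<in>Pow I. (x - 1) ^ card S * real (N (card S)))"
  proof (intro sum.cong refl)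
    fix S assume "S \<in> Pow I"
    have "(\<Sum>\<sigma>\<in>T. if \<forall>i\<in>S. Q \<sigma> i then (x - 1) ^ card S else 0)
        = (\<Sum>\<sigma>\<in>{\<sigma> \<in> T. \<forall>i\<in>S. Q \<sigma> i}. (x - 1) ^ card S)"
      by (rule sum.inter_filter[OF T, symmetric])
    also have "\<dots> = (x - 1) ^ card S * real (N (card S))"
      using \<open>S \<in> Pow I\<close> by (simp only: sum_constant N Pow_iff mult.commute)
    finally show "(\<Sum>\<sigma>\<in>T. if \<forall>i\<in>S. Q \<sigma> i then (x - 1) ^ card S else 0)
        = (x - 1) ^ card S * real (N (card S))" .
  qed
  also have "\<dots> = (\<Sum>k\<le>card I. real (card I choose k) * ((x - 1) ^ k * real (N k)))"
    by (rule sum_card_Pow[OF I])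
  finally show ?thesis .
qed

text \<open>For a fixed \<open>\<sigma>\<close>, the \<open>\<tau>\<close> that agree with it on
  \<open>S\<close> number \<open>fact (n - card S)\<close>, so the inner sum does not depend on
  \<open>\<sigma>\<close>. The binomial coefficient times \<open>fact (n - k)\<close> leaves
  \<open>fact n / fact k\<close>.\<close>

lemma sum_permutes_agreements:
  fixes x :: real
  shows "(\<Sum>\<sigma> | \<sigma> permutes {0..<n}. \<Sum>\<tau> | \<tau> permutes {0..<n}.
           \<Prod>i = 0..<n. if \<sigma> i = \<tau> i then x else 1)
       = (fact n)\<^sup>2 * (\<Sum>k\<le>n. (x - 1) ^ k / fact k)"
proof -
  have "(\<Sum>\<tau> | \<tau> permutes {0..<n}. \<Prod>i = 0..<n. if \<sigma> i = \<tau> i then x else 1)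
      = fact n * (\<Sum>k\<le>n. (x - 1) ^ k / fact k)" if \<sigma>: "\<sigma> permutes {0..<n}" for \<sigma>
  proof -
    have "card {\<tau> \<in> {\<tau>. \<tau> permutes {0..<n}}. \<forall>i\<in>S. \<sigma> i = \<tau> i} = fact (n - card S)"
      if "S \<subseteq> {0..<n}" for S
    proof -
      have "\<sigma> ` S \<subseteq> {0..<n}" using that permutes_image[OF \<sigma>] by blast
      then show ?thesis
        using card_permutes_extending[of "{0..<n}" S \<sigma>] that permutes_inj_on[OF \<sigma>]
        by (simp add: eq_commute[of "\<sigma> _"])
    qed
    then have "(\<Sum>\<tau> | \<tau> permutes {0..<n}. \<Prod>i = 0..<n. if \<sigma> i = \<tau> i then x else 1)
       = (\<Sum>k\<le>n. real (n choose k) * ((x - 1) ^ k * fact (n - k)))"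
      by (subst sum_prod_if_eq_binomial_sum[where N = "\<lambda>k. fact (n - k)"])
         (simp_all add: finite_permutations)
    also have "\<dots> = (\<Sum>k\<le>n. fact n * ((x - 1) ^ k / fact k))"
      by (intro sum.cong refl) (simp add: binomial_fact)
    finally show ?thesis by (simp add: sum_distrib_left)
  qed
  then have "(\<Sum>\<sigma> | \<sigma> permutes {0..<n}. \<Sum>\<tau> | \<tau> permutes {0..<n}.
           \<Prod>i = 0..<n. if \<sigma> i = \<tau> i then x else 1)
       = (\<Sum>\<sigma> | \<sigma> permutes {0..<n}. fact n * (\<Sum>k\<le>n. (x - 1) ^ k / fact k))"
    by (intro sum.cong refl) simp
  also have "\<dots> = (fact n)\<^sup>2 * (\<Sum>k\<le>n. (x - 1) ^ k / fact k)"
    by (simp add: card_permutations[of "{0..<n}" n] power2_eq_square)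
  finally show ?thesis .
qed

text \<open>Such a permutation amounts to three independent choices: an injection from
  \<open>S\<close> into the \<open>n\<close> pairs, an orientation of each image pair, and an
  arbitrary bijection between the remaining points. These give the three factors.\<close>

lemma card_permutes_preserving_pairs:
  assumes S: "S \<subseteq> {0..<n}"
  shows "card {\<sigma>. \<sigma> permutes {0..<2*n} \<and> (\<forall>i\<in>S. \<sigma> (2*i) div 2 = \<sigma> (2*i+1) div 2)}
       = (\<Prod>j = 0..<card S. n - j) * 2 ^ card S * fact (2 * n - 2 * card S)"
proof -
  \<comment> \<open>\<open>g\<close> says to which pair each pair in \<open>S\<close> is sent, and \<open>c\<close> in which of the two orientations.\<close>
  define G where "G = {g \<in> S \<rightarrow>\<^sub>E {0..<n}. inj_on g S} \<times> (S \<rightarrow>\<^sub>E {0..<2::nat})"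
  define Y where "Y = (\<lambda>i. 2*i) ` S \<union> (\<lambda>i. 2*i+1) ` S"
  \<comment> \<open>The even point of pair \<open>i\<close> goes to position \<open>c i\<close> of
    pair \<open>g i\<close>, the odd point to the other position.\<close>
  define f where "f = (\<lambda>(g, c) y. 2 * g (y div 2) + (c (y div 2) + y) mod 2 :: nat)"
  define F where "F h = {\<sigma>. \<sigma> permutes {0..<2*n} \<and> (\<forall>y\<in>Y. \<sigma> y = f h y)}" for h
  let ?T = "{\<sigma>. \<sigma> permutes {0..<2*n} \<and> (\<forall>i\<in>S. \<sigma> (2*i) div 2 = \<sigma> (2*i+1) div 2)}"
  have finS: "finite S" using S finite_subset by blast
  have card_Y: "card Y = 2 * card S"
  proof -
    have "(\<lambda>i. 2*i) ` S \<inter> (\<lambda>i. 2*i+1) ` S = {}"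
      by (auto simp: double_not_eq_Suc_double)
    moreover have "inj_on (\<lambda>i. 2*i) S" "inj_on (\<lambda>i. 2*i+1) S" by (auto simp: inj_on_def)
    ultimately show ?thesis
      unfolding Y_def using finS by (subst card_Un_disjoint) (simp_all add: card_image)
  qed
  have Y_sub: "Y \<subseteq> {0..<2*n}" using S by (auto simp: Y_def)
  have div_Y: "y div 2 \<in> S" if "y \<in> Y" for y using that by (auto simp: Y_def)
  have card_F: "card (F h) = fact (2 * n - 2 * card S)" if "h \<in> G" for h
  proof -
    obtain g c where h: "h = (g, c)" by (cases h)
    have g: "g \<in> S \<rightarrow> {0..<n}" "inj_on g S" using that by (auto simp: G_def h)
    have "inj_on (f h) Y"
    proof (rule inj_onI)
      fix y z assume yz: "y \<in> Y" "z \<in> Y" "f h y = f h z"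
      have "f h y div 2 = g (y div 2)" "f h z div 2 = g (z div 2)"
        by (simp_all add: f_def h)
      then have d: "y div 2 = z div 2"
        using yz g(2) div_Y by (metis inj_onD)
      moreover have "(c (y div 2) + y) mod 2 = (c (y div 2) + z) mod 2"
        using yz(3) d by (simp add: f_def h)
      then have "y mod 2 = z mod 2" by presburger
      ultimately show "y = z" by (metis div_mult_mod_eq)
    qed
    moreover have "f h y < 2 * n" if "y \<in> Y" for y
    proof -
      have "g (y div 2) < n" using g(1) div_Y[OF that] by auto
      moreover have "(c (y div 2) + y) mod 2 < 2" by simp
      ultimately show ?thesis unfolding f_def h by simp
    qed
    ultimately show ?thesis
      unfolding F_def using Y_sub
      by (subst card_permutes_extending) (auto simp: card_Y)
  qed
  have F_values: "\<sigma> (2*i) = 2 * g i + c i" "\<sigma> (2*i+1) = 2 * g i + (c i + 1) mod 2"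
    if "\<sigma> \<in> F (g, c)" "(g, c) \<in> G" "i \<in> S" for \<sigma> g c i
  proof -
    have "c i < 2" using that by (auto simp: G_def)
    moreover have "\<sigma> (2*i) = f (g, c) (2*i)" "\<sigma> (2*i+1) = f (g, c) (2*i+1)"
      using that by (auto simp: F_def Y_def)
    ultimately show "\<sigma> (2*i) = 2 * g i + c i" "\<sigma> (2*i+1) = 2 * g i + (c i + 1) mod 2"
      by (simp_all add: f_def mod_simps)
  qed
  \<comment> \<open>The quotient and remainder of \<open>\<sigma> (2*i)\<close> by 2 recover
    \<open>g i\<close> and \<open>c i\<close>, so \<open>\<sigma>\<close> determines both functions
    on \<open>S\<close>; off \<open>S\<close> they agree by extensionality.\<close>
  have disj: "F h \<inter> F h' = {}" if "h \<in> G" "h' \<in> G" "h \<noteq> h'" for h h'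
  proof (rule ccontr)
    assume "F h \<inter> F h' \<noteq> {}"
    then obtain \<sigma> where \<sigma>: "\<sigma> \<in> F h" "\<sigma> \<in> F h'" by auto
    obtain g c where h1: "h = (g, c)" by (cases h)
    obtain g' c' where h2: "h' = (g', c')" by (cases h')
    note h = h1 h2
    have "g i = g' i \<and> c i = c' i" if "i \<in> S" for i
    proof -
      have "2 * g i + c i = 2 * g' i + c' i"
        using F_values(1)[of \<sigma> g c i] F_values(1)[of \<sigma> g' c' i] \<sigma> \<open>h \<in> G\<close> \<open>h' \<in> G\<close> that
        by (simp add: h)
      moreover have "c i < 2" "c' i < 2"
        using \<open>h \<in> G\<close> \<open>h' \<in> G\<close> that by (auto simp: G_def h)
      ultimately show ?thesis by presburger
    qed
    moreover have "g \<in> S \<rightarrow>\<^sub>E {0..<n}" "g' \<in> S \<rightarrow>\<^sub>E {0..<n}"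
        "c \<in> S \<rightarrow>\<^sub>E {0..<2}" "c' \<in> S \<rightarrow>\<^sub>E {0..<2}"
      using \<open>h \<in> G\<close> \<open>h' \<in> G\<close> by (auto simp: G_def h)
    ultimately have "g = g'" "c = c'"
      using PiE_ext by metis+
    then show False using that(3) h by simp
  qed
  have "?T = (\<Union>h\<in>G. F h)"
  proof (intro equalityI subsetI)
    fix \<sigma> assume "\<sigma> \<in> ?T"
    then have \<sigma>: "\<sigma> permutes {0..<2*n}" "\<And>i. i \<in> S \<Longrightarrow> \<sigma> (2*i) div 2 = \<sigma> (2*i+1) div 2"
      by auto
    have inj: "\<sigma> a = \<sigma> b \<longleftrightarrow> a = b" for a b using permutes_inj[OF \<sigma>(1)] by (auto dest: injD)
    define g where "g = (\<lambda>i\<in>S. \<sigma> (2*i) div 2)"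
    define c where "c = (\<lambda>i\<in>S. \<sigma> (2*i) mod 2)"
    have "inj_on g S"
    proof (rule inj_onI)
      fix i j assume ij: "i \<in> S" "j \<in> S" "g i = g j"
      \<comment> \<open>Pigeonhole: if \<open>g i = g j\<close>, the three listed values lie in one
        pair, so two of them coincide. Injectivity and parity leave only
        \<open>i = j\<close>.\<close>
      have "\<sigma> (2*i) = \<sigma> (2*j) \<or> \<sigma> (2*i+1) = \<sigma> (2*j) \<or> \<sigma> (2*i) = \<sigma> (2*i+1)"
      proof -
        have "a = d \<or> b = d \<or> a = b" if "a div 2 = b div 2" "a div 2 = d div 2" for a b d :: nat
        proof -
          have "a mod 2 < 2" "b mod 2 < 2" "d mod 2 < 2" by simp_all
          moreover have "a = 2 * (a div 2) + a mod 2" "b = 2 * (b div 2) + b mod 2"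
            "d = 2 * (d div 2) + d mod 2" by simp_all
          ultimately show ?thesis using that by linarith
        qed
        then show ?thesis using ij \<sigma>(2)[of i] unfolding g_def by simp
      qed
      then show "i = j" unfolding inj by (simp add: double_not_eq_Suc_double Suc_double_not_eq_double)
    qed
    moreover have "\<sigma> (2*i) div 2 < n" if "i \<in> S" for i
    proof -
      have "2 * i \<in> {0..<2*n}" using that S by auto
      then have "\<sigma> (2*i) \<in> {0..<2*n}" using permutes_in_image[OF \<sigma>(1)] by blast
      then show ?thesis by auto
    qed
    ultimately have G: "(g, c) \<in> G"
      by (auto simp: G_def g_def c_def)
    have "\<sigma> y = f (g, c) y" if y: "y \<in> Y" for y
    proof -
      obtain i where i: "i \<in> S" "y = 2*i \<or> y = 2*i+1" using y unfolding Y_def by blast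
      have ne: "\<sigma> (2*i) \<noteq> \<sigma> (2*i+1)" unfolding inj by simp
      from i(2) show ?thesis
      proof
        assume "y = 2*i" then show ?thesis using i(1) by (simp add: f_def g_def c_def)
      next
        assume y: "y = 2*i+1"
        have "f (g, c) y = 2 * (\<sigma> (2*i) div 2) + (\<sigma> (2*i) mod 2 + (2*i+1)) mod 2"
          using i(1) y by (simp add: f_def g_def c_def)
        moreover have "\<sigma> (2*i+1) = 2 * (\<sigma> (2*i) div 2) + (\<sigma> (2*i) mod 2 + (2*i+1)) mod 2"
        proof -
          \<comment> \<open>Distinct members of one pair have opposite parity, so the first image
            and its orientation force the second image.\<close>
          have "b = 2 * (a div 2) + (a mod 2 + (2*i+1)) mod 2"
            if "a div 2 = b div 2" "a \<noteq> b" for a b :: nat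
          proof -
            have "a mod 2 \<noteq> b mod 2" using that by (metis div_mult_mod_eq)
            then have "b mod 2 = (a mod 2 + (2*i+1)) mod 2"
              by (cases "even a"; cases "even b") (simp_all add: mod2_eq_if)
            then show ?thesis using that(1) by (metis mult_div_mod_eq)
          qed
          then show ?thesis using ne \<sigma>(2)[OF i(1)] by blast
        qed
        ultimately show ?thesis using y by simp
      qed
    qed
    then show "\<sigma> \<in> (\<Union>h\<in>G. F h)"
      using G \<sigma>(1) by (auto simp: F_def)
  next
    fix \<sigma> assume "\<sigma> \<in> (\<Union>h\<in>G. F h)"
    then obtain g c where gc: "(g, c) \<in> G" "\<sigma> \<in> F (g, c)" by auto
    have "\<sigma> (2*i) div 2 = \<sigma> (2*i+1) div 2" if "i \<in> S" for i
    proof -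
      have "c i < 2" using gc(1) that by (auto simp: G_def)
      then show ?thesis using F_values[OF gc(2,1) that] by simp
    qed
    then show "\<sigma> \<in> ?T" using gc by (auto simp: F_def)
  qed
  moreover have "finite G"
    unfolding G_def using finS
    by (intro finite_cartesian_product finite_PiE finite_subset[OF _ finite_PiE[of S "\<lambda>_. {0..<n}"]]) auto
  moreover have "finite (F h)" for h
    unfolding F_def by (rule finite_subset[OF _ finite_permutations[of "{0..<2*n}"]]) auto
  ultimately have "card ?T = (\<Sum>h\<in>G. card (F h))"
    using disj by (simp add: card_UN_disjoint)
  also have "\<dots> = card G * fact (2 * n - 2 * card S)"
    by (simp add: card_F)
  also have "card G = (\<Prod>j = 0..<card S. n - j) * 2 ^ card S"
    using card_inj_on_subset_funcset[OF finS, of "{0..<n}" S] finS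
    by (simp add: G_def card_cartesian_product card_funcsetE)
  finally show ?thesis .
qed

lemma prod_diff_mult_fact: "k \<le> n \<Longrightarrow> (\<Prod>j = 0..<k. n - j) * fact (n - k) = (fact n :: nat)"
proof (induction k)
  case (Suc k)
  have "fact (n - k) = (n - k) * fact (n - Suc k)"
    using Suc.prems by (metis Suc_diff_Suc Suc_le_lessD fact_Suc of_nat_id)
  then show ?case using Suc by (simp add: mult.assoc)
qed simp

text \<open>The weight \<open>2 * r\<close> is the quotient of the two contributions of a row pair,
  second moment over 2 against squared mean over 4. After inclusion-exclusion,
  \<open>fact (2*m) = 4 ^ m * pochhammer (1/2) m * fact m\<close> with \<open>m = n - k\<close>
  brings out the coefficients of the inverse square root of \<open>1 - x\<close>.\<close>

lemma sum_permutes_preserved_pairs: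
  fixes r :: real
  shows "(\<Sum>\<sigma> | \<sigma> permutes {0..<2*n}.
           \<Prod>i = 0..<n. if \<sigma> (2*i) div 2 = \<sigma> (2*i+1) div 2 then 2 * r else 1)
       = 4 ^ n * (fact n)\<^sup>2 *
         (\<Sum>k\<le>n. (r - 1/2) ^ k / fact k * (pochhammer (1/2) (n - k) / fact (n - k)))"
proof -
  let ?N = "\<lambda>k. (\<Prod>j = 0..<k. n - j) * 2 ^ k * fact (2 * n - 2 * k)"
  have "(\<Sum>\<sigma> | \<sigma> permutes {0..<2*n}.
           \<Prod>i = 0..<n. if \<sigma> (2*i) div 2 = \<sigma> (2*i+1) div 2 then 2 * r else 1)
      = (\<Sum>k\<le>n. real (n choose k) * ((2 * r - 1) ^ k * real (?N k)))"
    using card_permutes_preserving_pairs[of _ n]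
    by (subst sum_prod_if_eq_binomial_sum[where N = ?N]) (simp_all add: finite_permutations)
  also have "\<dots> = (\<Sum>k\<le>n. 4 ^ n * (fact n)\<^sup>2 *
      ((r - 1/2) ^ k / fact k * (pochhammer (1/2) (n - k) / fact (n - k))))"
  proof (intro sum.cong refl)
    fix k assume "k \<in> {..n}"
    then have k: "k \<le> n" by simp
    have 1: "real (\<Prod>j = 0..<k. n - j) = fact n / fact (n - k)"
      using prod_diff_mult_fact[OF k, THEN arg_cong[where f = real]]
      by (simp add: field_simps)
    have 2: "fact (2 * n - 2 * k) = (4 ^ (n - k) * pochhammer (1/2) (n - k) * fact (n - k) :: real)"
    proof -
      have "(2::real) ^ (2 * (n - k)) = 4 ^ (n - k)" by (simp add: power_mult)
      moreover have "2 * n - 2 * k = 2 * (n - k)" by (simp add: diff_mult_distrib2)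
      ultimately show ?thesis by (simp only: fact_double)
    qed
    \<comment> \<open>The \<open>2 ^ k\<close> orientations turn \<open>2 * r - 1\<close> into
      \<open>4 * (r - 1/2)\<close>, which completes the power of 4 left by the double factorial to
      \<open>4 ^ n\<close>.\<close>
    have 3: "(2 * r - 1) ^ k * 2 ^ k = (r - 1/2) ^ k * 4 ^ k"
    proof -
      have "(2 * r - 1) * 2 = (r - 1/2) * 4" by simp
      then show ?thesis by (metis power_mult_distrib)
    qed
    have 4: "(4::real) ^ n = 4 ^ k * 4 ^ (n - k)" using k by (simp flip: power_add)
    have "real (n choose k) * ((2 * r - 1) ^ k * real (?N k))
        = real (n choose k) * ((2 * r - 1) ^ k * 2 ^ k)
          * (real (\<Prod>j = 0..<k. n - j) * fact (2 * n - 2 * k))"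
      by simp
    also have "\<dots> = (fact n / (fact k * fact (n - k))) * ((r - 1/2) ^ k * 4 ^ k)
        * ((fact n / fact (n - k)) * (4 ^ (n - k) * pochhammer (1/2) (n - k) * fact (n - k)))"
      unfolding 1 2 3 binomial_fact[OF k] ..
    also have "\<dots> = 4 ^ n * (fact n)\<^sup>2 *
      ((r - 1/2) ^ k / fact k * (pochhammer (1/2) (n - k) / fact (n - k)))"
      unfolding 4 by (simp add: power2_eq_square)
    finally show "real (n choose k) * ((2 * r - 1) ^ k * real (?N k)) = 4 ^ n * (fact n)\<^sup>2 *
      ((r - 1/2) ^ k / fact k * (pochhammer (1/2) (n - k) / fact (n - k)))" .
  qed
  finally show ?thesis by (simp add: sum_distrib_left)
qed

subsection \<open>Asymptotics of the coefficients\<close>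

text \<open>This is the limit formula for the Gamma function at 1/2, inverted, together with the
  value \<open>sqrt pi\<close> there.\<close>

lemma pochhammer_half_asymp:
  "(\<lambda>n. pochhammer (1/2) n / fact n * sqrt (real n)) \<longlonglongrightarrow> 1 / sqrt pi"
proof -
  have "(\<lambda>n. inverse (Gamma_series' (1/2 :: real) n)) \<longlonglongrightarrow> inverse (sqrt pi)"
    using tendsto_inverse[OF Gamma_series'_LIMSEQ[of "1/2 :: real"]]
    by (simp add: Gamma_one_half_real)
  moreover have "\<forall>\<^sub>F n in sequentially. inverse (Gamma_series' (1/2 :: real) n)
      = pochhammer (1/2) n / fact n * sqrt (real n)"
  proof (rule eventually_mono[OF eventually_gt_at_top[of 0]])
    fix n :: nat assume n: "n > 0"
    have "exp (ln (real n) / 2) = sqrt (real n)"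
      using n by (simp add: ln_sqrt[symmetric])
    moreover have "(fact n :: real) = real n * fact (n - 1)"
      using n by (simp add: fact_reduce)
    moreover have "real n = sqrt (real n) * sqrt (real n)" by simp
    ultimately show "inverse (Gamma_series' (1/2 :: real) n)
        = pochhammer (1/2) n / fact n * sqrt (real n)"
      using n unfolding Gamma_series'_def by (simp add: field_simps)
  qed
  ultimately show ?thesis
    by (simp add: tendsto_cong inverse_eq_divide)
qed

lemma pochhammer_half_pos: "pochhammer (1/2) n / fact n > (0::real)"
  by (simp add: pochhammer_pos)

text \<open>Consecutive coefficients have ratio \<open>(1/2 + j) / (1 + j)\<close>, which is at
  least 1/2. The bound supplies the domination for the limit under the sum below.\<close>

lemma pochhammer_half_shift_le:
  "pochhammer (1/2) m / fact m \<le> (2::real) ^ k * (pochhammer (1/2) (m + k) / fact (m + k))"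
proof (induction k)
  case (Suc k)
  define b :: "nat \<Rightarrow> real" where "b m = pochhammer (1/2) m / fact m" for m
  have step: "b j \<le> 2 * b (Suc j)" for j
  proof -
    have "b (Suc j) = b j * ((1/2 + real j) / (1 + real j))"
      by (simp add: b_def pochhammer_Suc)
    moreover have "(1/2 + real j) / (1 + real j) \<ge> 1 / 2" by (simp add: field_simps)
    moreover have "b j > 0" unfolding b_def by (rule pochhammer_half_pos)
    ultimately have "b j * (1 / 2) \<le> b (Suc j)"
      by (simp only: mult_left_mono less_imp_le)
    then show ?thesis by simp
  qed
  have "b m \<le> 2 ^ k * b (m + k)" using Suc by (simp add: b_def)
  also have "\<dots> \<le> 2 ^ k * (2 * b (Suc (m + k)))" by (intro mult_left_mono step) simp
  also have "\<dots> = 2 ^ Suc k * b (m + Suc k)" by simp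
  finally show ?case by (simp only: b_def)
qed simp

lemma pochhammer_half_shift_tendsto:
  "(\<lambda>n. (pochhammer (1/2) (n - k) / fact (n - k)) / (pochhammer (1/2) n / fact n)) \<longlonglongrightarrow> (1::real)"
\<comment> \<open>Shifting the index by \<open>k\<close> removes the truncated subtraction
  \<open>n - k\<close>.\<close>
proof (rule LIMSEQ_offset[of _ k])
  define b :: "nat \<Rightarrow> real" where "b m = pochhammer (1/2) m / fact m" for m
  have lim: "(\<lambda>n. b n * sqrt (real n)) \<longlonglongrightarrow> 1 / sqrt pi"
    unfolding b_def by (rule pochhammer_half_asymp)
  have "(\<lambda>n. (b n * sqrt (real n)) / (b (n + k) * sqrt (real (n + k))) * sqrt (real (n + k) / real n))
      \<longlonglongrightarrow> (1 / sqrt pi) / (1 / sqrt pi) * sqrt 1"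
    by (intro tendsto_mult tendsto_divide lim LIMSEQ_ignore_initial_segment[OF lim] tendsto_real_sqrt)
       (simp, real_asymp)
  moreover have "\<forall>\<^sub>F n in sequentially.
      (b n * sqrt (real n)) / (b (n + k) * sqrt (real (n + k))) * sqrt (real (n + k) / real n)
      = b n / b (n + k)"
    by (rule eventually_mono[OF eventually_gt_at_top[of 0]]) (simp add: real_sqrt_divide)
  ultimately show "(\<lambda>n. pochhammer (1/2) (n + k - k) / fact (n + k - k)
      / (pochhammer (1/2) (n + k) / fact (n + k))) \<longlonglongrightarrow> (1::real)"
    by (simp add: tendsto_cong b_def)
qed

lemma exp_partial_sums: "(\<lambda>n. \<Sum>k\<le>n. c ^ k / fact k) \<longlonglongrightarrow> exp (c::real)"
  using exp_converges[of c] by (simp add: sums_def_le divide_inverse mult.commute)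

text \<open>For each fixed \<open>k\<close> the shifted coefficient divided by the unshifted one
  tends to 1, so termwise the exponential series remains. Tannery's theorem justifies the exchange,
  with dominating terms \<open>(2 * \<bar>c\<bar>) ^ k / fact k\<close>.\<close>

lemma exp_convolution_tendsto:
  fixes c :: real
  shows "(\<lambda>n. (\<Sum>k\<le>n. c ^ k / fact k * (pochhammer (1/2) (n - k) / fact (n - k)))
            / (pochhammer (1/2) n / fact n)) \<longlonglongrightarrow> exp c"
proof -
  define b :: "nat \<Rightarrow> real" where "b m = pochhammer (1/2) m / fact m" for m
  \<comment> \<open>Extension by zero beyond \<open>n\<close> makes the growing finite sums into
    series over all \<open>k\<close>, as Tannery's theorem requires.\<close>
  define a where "a k n = (if k \<le> n then c ^ k / fact k * (b (n - k) / b n) else 0)" for k n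
  have b_pos: "b n > 0" for n unfolding b_def by (rule pochhammer_half_pos)
  have lim: "(\<lambda>n. a k n) \<longlonglongrightarrow> c ^ k / fact k" for k
  proof -
    have "(\<lambda>n. c ^ k / fact k * (b (n - k) / b n)) \<longlonglongrightarrow> c ^ k / fact k * 1"
      unfolding b_def by (intro tendsto_mult tendsto_const pochhammer_half_shift_tendsto)
    moreover have "\<forall>\<^sub>F n in sequentially. a k n = c ^ k / fact k * (b (n - k) / b n)"
      by (rule eventually_mono[OF eventually_ge_at_top[of k]]) (simp add: a_def)
    ultimately show ?thesis by (simp add: tendsto_cong)
  qed
  have bound: "norm (a k n) \<le> (2 * \<bar>c\<bar>) ^ k / fact k" for k n
  proof (cases "k \<le> n")
    case True
    then have "b (n - k) \<le> 2 ^ k * b n"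
      using pochhammer_half_shift_le[of "n - k" k] by (simp add: b_def)
    then have "b (n - k) / b n \<le> 2 ^ k"
      using b_pos[of n] by (simp add: field_simps)
    then have "\<bar>c\<bar> ^ k / fact k * (b (n - k) / b n) \<le> \<bar>c\<bar> ^ k / fact k * 2 ^ k"
      by (intro mult_left_mono) simp_all
    then show ?thesis
      using True b_pos[of n] b_pos[of "n - k"]
      by (simp add: a_def abs_mult power_abs power_mult_distrib mult.commute)
  qed (simp add: a_def)
  have "(\<lambda>n. \<Sum>k. a k n) \<longlonglongrightarrow> (\<Sum>k. c ^ k / fact k)"
    using tannerys_theorem[of a "\<lambda>k. c ^ k / fact k" sequentially "\<lambda>k. (2 * \<bar>c\<bar>) ^ k / fact k"]
      lim bound summable_exp[of "2 * \<bar>c\<bar>"]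
    by (simp add: always_eventually divide_inverse mult.commute)
  moreover have "(\<Sum>k. c ^ k / fact k) = exp c"
    by (simp add: exp_def divide_inverse mult.commute)
  moreover have "(\<Sum>k. a k n) = (\<Sum>k\<le>n. c ^ k / fact k * b (n - k)) / b n" for n
  proof -
    have "(\<Sum>k. a k n) = (\<Sum>k\<le>n. a k n)"
      by (rule suminf_finite) (auto simp: a_def)
    also have "\<dots> = (\<Sum>k\<le>n. c ^ k / fact k * b (n - k)) / b n"
      by (simp add: a_def sum_divide_distrib)
    finally show ?thesis .
  qed
  ultimately show ?thesis by (simp add: b_def)
qed

text \<open>The numerator tends to \<open>exp (r - 1)\<close> and the denominator behaves like
  \<open>exp (r - 1/2) / sqrt (pi * n)\<close>. In the quotient \<open>r\<close> cancels and
  \<open>exp (-1/2) * sqrt (pi * n)\<close> remains, whose square root is the stated fourth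
  root.\<close>

lemma sqrt_ratio_asymp_equiv:
  fixes r :: real
  shows "(\<lambda>n. sqrt ((\<Sum>k\<le>n. (r - 1) ^ k / fact k)
             / (\<Sum>k\<le>n. (r - 1/2) ^ k / fact k * (pochhammer (1/2) (n - k) / fact (n - k)))))
         \<sim>[at_top] (\<lambda>n. root 4 (pi * real n / exp 1))"
proof (rule asymp_equivI')
  define b :: "nat \<Rightarrow> real" where "b m = pochhammer (1/2) m / fact m" for m
  define P where "P n = (\<Sum>k\<le>n. (r - 1) ^ k / fact k)" for n
  define Q where "Q n = (\<Sum>k\<le>n. (r - 1/2) ^ k / fact k * b (n - k))" for n
  have b_pos: "b n > 0" for n unfolding b_def by (rule pochhammer_half_pos)
  \<comment> \<open>The expression is the square of the ratio to be shown to tend to 1, arranged so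
    that every factor converges on its own.\<close>
  have "(\<lambda>n. P n / (Q n / b n) / (b n * sqrt (real n)) / sqrt pi * sqrt (exp 1))
      \<longlonglongrightarrow> exp (r - 1) / exp (r - 1/2) / (1 / sqrt pi) / sqrt pi * sqrt (exp 1)"
    unfolding P_def Q_def b_def
    by (intro tendsto_mult tendsto_divide tendsto_const exp_partial_sums exp_convolution_tendsto
          pochhammer_half_asymp) auto
  also have "exp (r - 1) / exp (r - 1/2) / (1 / sqrt pi) / sqrt pi * sqrt (exp 1) = 1"
  proof -
    have "sqrt (exp 1) = exp (1/2 :: real)"
      by (rule real_sqrt_unique) (simp_all add: power2_eq_square flip: exp_add)
    then show ?thesis by (simp flip: exp_diff exp_add)
  qed
  finally have "(\<lambda>n. sqrt (P n / (Q n / b n) / (b n * sqrt (real n)) / sqrt pi * sqrt (exp 1))) \<longlonglongrightarrow> sqrt 1"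
    by (rule tendsto_real_sqrt)
  \<comment> \<open>At \<open>n = 0\<close> both sides contain a division by zero and are 0, so the
    identity holds for all \<open>n\<close>.\<close>
  moreover have "sqrt (P n / (Q n / b n) / (b n * sqrt (real n)) / sqrt pi * sqrt (exp 1))
      = sqrt (P n / Q n) / root 4 (pi * real n / exp 1)" for n
  proof -
    have "root 4 x = sqrt (sqrt x)" for x
      using real_root_mult_exp[of 2 2 x] by (simp add: sqrt_def)
    then show ?thesis
      using b_pos[of n] by (simp add: real_sqrt_divide real_sqrt_mult)
  qed
  ultimately show "(\<lambda>n. sqrt ((\<Sum>k\<le>n. (r - 1) ^ k / fact k)
             / (\<Sum>k\<le>n. (r - 1/2) ^ k / fact k * (pochhammer (1/2) (n - k) / fact (n - k))))
         / root 4 (pi * real n / exp 1)) \<longlonglongrightarrow> 1"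
    by (simp add: P_def Q_def b_def)
qed

subsection \<open>Averaging over the lifts\<close>

text \<open>Describes one row of cells in which columns \<open>s\<close> and \<open>t\<close> are
  selected, possibly the same one. It evaluates such rows both in the average over lifts and in the
  expectation over entries.\<close>

lemma prod_two_marked:
  fixes u v :: "'a :: comm_monoid_mult"
  assumes "finite J" "s \<in> J" "t \<in> J"
  shows "(\<Prod>j\<in>J. if j = s \<and> j = t then u else if j = s \<or> j = t then v else 1)
       = (if s = t then u else v * v)"
proof (cases "s = t")
  case True
  then have "(\<Prod>j\<in>J. if j = s \<and> j = t then u else if j = s \<or> j = t then v else 1)
      = (\<Prod>j\<in>J. if j = s then u else 1)"
    by (intro prod.cong) auto
  then show ?thesis using assms True by simp
next
  case False
  then have "(\<Prod>j\<in>J. if j = s \<and> j = t then u else if j = s \<or> j = t then v else 1)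
      = (\<Prod>j\<in>J. (if j = s then v else 1) * (if j = t then v else 1))"
    by (intro prod.cong) auto
  then show ?thesis using assms False by (simp add: prod.distrib)
qed

lemma prod_atLeast0LessThan_double:
  fixes f :: "nat \<Rightarrow> 'a :: comm_monoid_mult"
  shows "(\<Prod>r = 0..<2*n. f r) = (\<Prod>i = 0..<n. f (2*i) * f (2*i+1))"
  by (induction n) (simp_all add: mult.assoc)

lemma permutation_mats_2:
  "permutation_mats 2 = {mat 2 2 (\<lambda>(r, c). if r = c then 1 else 0),
                         mat 2 2 (\<lambda>(r, c). if r = c then 0 else 1)}"
proof -
  have "{\<sigma>. \<sigma> permutes {0..<2::nat}} = {id, Transposition.transpose 0 1}"
  proof -
    have "{0..<2::nat} = {0, 1}" by auto
    then show ?thesis using permutes_doubleton_iff[of _ "0::nat" 1] by auto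
  qed
  then have "permutation_mats 2
      = (\<lambda>\<sigma>. mat 2 2 (\<lambda>(r, c). if \<sigma> r = c then 1 else 0)) ` {id, Transposition.transpose 0 1}"
    unfolding permutation_mats_def by (simp only: setcompr_eq_image)
  moreover have "mat 2 2 (\<lambda>(r, c). if Transposition.transpose 0 1 r = c then 1 else 0)
      = (mat 2 2 (\<lambda>(r, c). if r = c then 0 else 1) :: real mat)"
    by (rule eq_matI) (auto simp: Transposition.transpose_def)
  ultimately show ?thesis by simp
qed

lemma sum_permutation_mats_2:
  "(\<Sum>Q\<in>permutation_mats 2. h Q)
     = h (mat 2 2 (\<lambda>(r, c). if r = c then 1 else 0)) + h (mat 2 2 (\<lambda>(r, c). if r = c then 0 else 1))"
proof -
  have "mat 2 2 (\<lambda>(r, c). if r = c then 1 else 0) \<noteq> (mat 2 2 (\<lambda>(r, c). if r = c then 0 else 1) :: real mat)"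
    (is "?I \<noteq> ?X")
  proof
    assume "?I = ?X"
    then have "?I $$ (0, 0) = ?X $$ (0, 0)" by simp
    then show False by simp
  qed
  then show ?thesis unfolding permutation_mats_2 by simp
qed

text \<open>The blocks of a uniform lift are independent, so the average factors over the cells. A
  block used once contributes 1/2. A block used by both rows also contributes only 1/2, since
  \<open>u i \<noteq> v i\<close> makes the two entries equal to 1 for the same permutation
  matrix.\<close>

lemma average_prod_lift:
  fixes s t u v :: "nat \<Rightarrow> nat"
  assumes s: "\<And>i. i < n \<Longrightarrow> s i < n" and t: "\<And>i. i < n \<Longrightarrow> t i < n"
    and u: "\<And>i. i < n \<Longrightarrow> u i < 2" and v: "\<And>i. i < n \<Longrightarrow> v i < 2"
    and uv: "\<And>i. i < n \<Longrightarrow> s i = t i \<Longrightarrow> u i \<noteq> v i"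
  shows "(\<Sum>P\<in>lift_families n 2. \<Prod>i = 0..<n. P (i, s i) $$ (0, u i) * P (i, t i) $$ (1, v i))
           / real (card (lift_families n 2))
       = (\<Prod>i = 0..<n. if s i = t i then 1/2 else 1/4)"
proof -
  let ?C = "{0..<n} \<times> {0..<n}"
  define G where "G = (\<lambda>(i, j) (Q :: real mat).
    (if j = s i then Q $$ (0, u i) else 1) * (if j = t i then Q $$ (1, v i) else 1))"
  have fin: "finite (permutation_mats 2)" unfolding permutation_mats_2 by simp
  have "real (card (permutation_mats 2)) = (\<Sum>Q\<in>permutation_mats 2. 1)" by simp
  then have card2: "real (card (permutation_mats 2)) = 2"
    unfolding sum_permutation_mats_2 by simp
  have G_prod: "(\<Prod>c\<in>?C. G c (P c)) = (\<Prod>i = 0..<n. P (i, s i) $$ (0, u i) * P (i, t i) $$ (1, v i))" for P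
  proof -
    have "(\<Prod>c\<in>?C. G c (P c)) = (\<Prod>i = 0..<n. \<Prod>j = 0..<n. G (i, j) (P (i, j)))"
      by (simp add: prod.cartesian_product)
    also have "\<dots> = (\<Prod>i = 0..<n. P (i, s i) $$ (0, u i) * P (i, t i) $$ (1, v i))"
      using s t by (intro prod.cong refl) (simp add: G_def prod.distrib prod.delta)
    finally show ?thesis .
  qed
  \<comment> \<open>The 2 split off counts the permutation matrices; over all cells it accumulates
    to the number of lifts.\<close>
  have G_sum: "(\<Sum>Q\<in>permutation_mats 2. G (i, j) Q)
      = 2 * (if j = s i \<and> j = t i then 1/2 else if j = s i \<or> j = t i then 1/2 else 1)"
    if "i < n" for i j
  proof -
    have uv': "u i = 0 \<or> u i = 1" "v i = 0 \<or> v i = 1" using u[OF that] v[OF that] by auto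
    then show ?thesis
      using uv[OF that] unfolding sum_permutation_mats_2 G_def by auto
  qed
  have "(\<Sum>P\<in>lift_families n 2. \<Prod>i = 0..<n. P (i, s i) $$ (0, u i) * P (i, t i) $$ (1, v i))
      = (\<Prod>c\<in>?C. \<Sum>Q\<in>permutation_mats 2. G c Q)"
    unfolding lift_families_def by (simp add: prod_sum_PiE fin G_prod)
  also have "\<dots> = (\<Prod>i = 0..<n. \<Prod>j = 0..<n. \<Sum>Q\<in>permutation_mats 2. G (i, j) Q)"
    by (simp add: prod.cartesian_product)
  also have "\<dots> = (\<Prod>i = 0..<n. \<Prod>j = 0..<n.
      2 * (if j = s i \<and> j = t i then 1/2 else if j = s i \<or> j = t i then 1/2 else 1))"
    by (intro prod.cong refl) (simp only: G_sum atLeastLessThan_iff)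
  also have "\<dots> = (\<Prod>i = 0..<n. 2 ^ n * (if s i = t i then 1/2 else 1/4))"
  proof (intro prod.cong refl)
    fix i assume "i \<in> {0..<n}"
    then have "s i \<in> {0..<n}" "t i \<in> {0..<n}" using s t by auto
    then show "(\<Prod>j = 0..<n. 2 * (if j = s i \<and> j = t i then 1/2 else if j = s i \<or> j = t i then 1/2 else 1))
        = 2 ^ n * (if s i = t i then 1/2 else 1/4 :: real)"
      by (simp only: prod.distrib prod_two_marked finite_atLeastLessThan) simp
  qed
  also have "\<dots> = real (card (lift_families n 2)) * (\<Prod>i = 0..<n. if s i = t i then 1/2 else 1/4)"
    unfolding lift_families_def
    by (simp add: prod.distrib card_funcsetE card2 power_mult)
  finally show ?thesis
    by (simp add: lift_families_def card_funcsetE card2)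
qed

text \<open>Rows \<open>2*i\<close> and \<open>2*i+1\<close> of the lifted matrix form block row
  \<open>i\<close>. Each term of its permanent splits into a product of entries of \<open>B\<close>
  and a product of entries of the lift, and only the latter is averaged.\<close>

lemma average_permanent_lifted_mat:
  assumes B: "B \<in> carrier_mat n n"
  shows "(\<Sum>P\<in>lift_families n 2. permanent (lifted_mat 2 B P)) / real (card (lift_families n 2))
       = (\<Sum>\<sigma> | \<sigma> permutes {0..<2*n}.
            (\<Prod>i = 0..<n. if \<sigma> (2*i) div 2 = \<sigma> (2*i+1) div 2 then 1/2 else 1/4)
            * (\<Prod>i = 0..<n. B $$ (i, \<sigma> (2*i) div 2) * B $$ (i, \<sigma> (2*i+1) div 2)))"
proof -
  define W where "W \<sigma> = (\<Prod>i = 0..<n. B $$ (i, \<sigma> (2*i) div 2) * B $$ (i, \<sigma> (2*i+1) div 2))"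
    for \<sigma> :: "nat \<Rightarrow> nat"
  define H where "H \<sigma> P = (\<Prod>i = 0..<n. P (i, \<sigma> (2*i) div 2) $$ (0, \<sigma> (2*i) mod 2)
      * P (i, \<sigma> (2*i+1) div 2) $$ (1, \<sigma> (2*i+1) mod 2))"
    for \<sigma> :: "nat \<Rightarrow> nat" and P :: "nat \<times> nat \<Rightarrow> real mat"
  have perm: "permanent (lifted_mat 2 B P) = (\<Sum>\<sigma> | \<sigma> permutes {0..<2*n}. W \<sigma> * H \<sigma> P)" for P
  proof -
    have dims: "dim_row B = n" "dim_col B = n" using B by auto
    have "(\<Prod>r = 0..<2*n. lifted_mat 2 B P $$ (r, \<sigma> r)) = W \<sigma> * H \<sigma> P"
      if "\<sigma> permutes {0..<2*n}" for \<sigma>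
    proof -
      have "\<sigma> r < 2 * n" if "r < 2 * n" for r
        using permutes_in_image[OF \<open>\<sigma> permutes {0..<2*n}\<close>, of r] that by simp
      then have "(\<Prod>r = 0..<2*n. lifted_mat 2 B P $$ (r, \<sigma> r))
          = (\<Prod>r = 0..<2*n. B $$ (r div 2, \<sigma> r div 2) * P (r div 2, \<sigma> r div 2) $$ (r mod 2, \<sigma> r mod 2))"
        by (intro prod.cong refl) (simp add: lifted_mat_def dims)
      also have "\<dots> = W \<sigma> * H \<sigma> P"
      proof -
        have "Suc (i * 2) mod 2 = 1" for i by presburger
        then show ?thesis
          unfolding prod_atLeast0LessThan_double W_def H_def by (simp add: prod.distrib mult_ac)
      qed
      finally show ?thesis .
    qed
    then show ?thesis
      unfolding permanent_def by (simp add: lifted_mat_def dims)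
  qed
  have avg: "(\<Sum>P\<in>lift_families n 2. H \<sigma> P) / real (card (lift_families n 2))
      = (\<Prod>i = 0..<n. if \<sigma> (2*i) div 2 = \<sigma> (2*i+1) div 2 then 1/2 else 1/4)"
    if \<sigma>: "\<sigma> permutes {0..<2*n}" for \<sigma>
    unfolding H_def
  proof (rule average_prod_lift)
    fix i assume i: "i < n"
    have "\<sigma> (2*i) \<in> {0..<2*n}" "\<sigma> (2*i+1) \<in> {0..<2*n}"
      using i permutes_in_image[OF \<sigma>] by simp_all
    then show "\<sigma> (2*i) div 2 < n" "\<sigma> (2*i+1) div 2 < n" by auto
    \<comment> \<open>Two different columns of one block column have different remainders, which is
      the condition needed when both rows use the same block.\<close>
    have "\<sigma> (2*i) \<noteq> \<sigma> (2*i+1)" using permutes_inj[OF \<sigma>] by (simp add: inj_eq)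
    then show "\<sigma> (2*i) mod 2 \<noteq> \<sigma> (2*i+1) mod 2" if "\<sigma> (2*i) div 2 = \<sigma> (2*i+1) div 2"
      using that by (metis div_mult_mod_eq)
  qed simp_all
  have "(\<Sum>P\<in>lift_families n 2. permanent (lifted_mat 2 B P)) / real (card (lift_families n 2))
      = (\<Sum>\<sigma> | \<sigma> permutes {0..<2*n}. W \<sigma> * ((\<Sum>P\<in>lift_families n 2. H \<sigma> P) / real (card (lift_families n 2))))"
    unfolding perm by (subst sum.swap) (simp add: sum_divide_distrib sum_distrib_left)
  also have "\<dots> = (\<Sum>\<sigma> | \<sigma> permutes {0..<2*n}.
            (\<Prod>i = 0..<n. if \<sigma> (2*i) div 2 = \<sigma> (2*i+1) div 2 then 1/2 else 1/4) * W \<sigma>)"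
    by (intro sum.cong refl) (simp only: avg mem_Collect_eq mult.commute)
  finally show ?thesis by (simp add: W_def)
qed

subsection \<open>Second moments\<close>

text \<open>The size is fixed here, because the second moments are evaluated exactly for each
  \<open>n\<close>; the probability space may change with \<open>n\<close>.\<close>

locale iid_nonneg_matrix = prob_space \<Omega>
  for \<Omega> :: "'w measure" +
  fixes D :: "real measure" and n :: nat and A :: "'w \<Rightarrow> real mat"
  assumes real_distribution: "real_distribution D"
    and nonneg: "AE x in D. 0 \<le> x"
    and integrable_fst: "integrable D (\<lambda>x. x)"
    and mean_pos: "(LINT x|D. x) > 0"
    and integrable_snd: "integrable D (\<lambda>x. x\<^sup>2)"
    and iid: "iid_random_matrix \<Omega> D n A"
begin

definition "m1 = (LINT x|D. x)"
definition "m2 = (LINT x|D. x\<^sup>2)"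

lemma carrier: "\<omega> \<in> space \<Omega> \<Longrightarrow> A \<omega> \<in> carrier_mat n n"
  using iid by (simp add: iid_random_matrix_def)

lemma indep_entries: "indep_vars (\<lambda>_. borel) (\<lambda>ij \<omega>. A \<omega> $$ ij) ({0..<n} \<times> {0..<n})"
  using iid by (simp add: iid_random_matrix_def)

lemma distr_entry:
  assumes "i < n" "j < n"
  shows "distr \<Omega> borel (\<lambda>\<omega>. A \<omega> $$ (i, j)) = D"
proof -
  have "\<forall>ij \<in> {0..<n} \<times> {0..<n}. distr \<Omega> borel (\<lambda>\<omega>. A \<omega> $$ ij) = D"
    using iid unfolding iid_random_matrix_def by blast
  then show ?thesis using assms by simp
qed

lemma entry_measurable [measurable]:
  assumes "i < n" "j < n"
  shows "(\<lambda>\<omega>. A \<omega> $$ (i, j)) \<in> borel_measurable \<Omega>"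
  using indep_entries assms unfolding indep_vars_def2 by auto

lemma
  fixes h :: "real \<Rightarrow> real"
  assumes "i < n" "j < n" "h \<in> borel_measurable borel"
  shows integrable_entry: "integrable D h \<Longrightarrow> integrable \<Omega> (\<lambda>\<omega>. h (A \<omega> $$ (i, j)))"
    and expectation_entry: "expectation (\<lambda>\<omega>. h (A \<omega> $$ (i, j))) = (LINT x|D. h x)"
  using integrable_distr_eq[OF entry_measurable[OF assms(1,2)] assms(3)]
    integral_distr[OF entry_measurable[OF assms(1,2)] assms(3)]
  unfolding distr_entry[OF assms(1,2)] by simp_all

lemma AE_entries_nonneg: "AE \<omega> in \<Omega>. \<forall>i\<in>{0..<n}. \<forall>j\<in>{0..<n}. 0 \<le> A \<omega> $$ (i, j)"
proof -
  have "AE \<omega> in \<Omega>. 0 \<le> A \<omega> $$ (i, j)" if "i < n" "j < n" for i j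
    using nonneg AE_distr_iff[OF entry_measurable[OF that], of "\<lambda>x. 0 \<le> x"]
    unfolding distr_entry[OF that] by simp
  then show ?thesis by (simp add: AE_ball_countable)
qed

text \<open>The product is rewritten over all cells, with the square, the identity or the constant 1
  applied to the entry according to how often the cell is selected. Independence then gives
  integrability and factors the expectation.\<close>

lemma
  assumes s: "\<And>i. i < n \<Longrightarrow> s i < n" and t: "\<And>i. i < n \<Longrightarrow> t i < n"
  shows integrable_prod_entries:
      "integrable \<Omega> (\<lambda>\<omega>. \<Prod>i = 0..<n. A \<omega> $$ (i, s i) * A \<omega> $$ (i, t i))"
    and expectation_prod_entries:
      "expectation (\<lambda>\<omega>. \<Prod>i = 0..<n. A \<omega> $$ (i, s i) * A \<omega> $$ (i, t i))
       = (\<Prod>i = 0..<n. if s i = t i then m2 else m1\<^sup>2)"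
proof -
  let ?C = "{0..<n} \<times> {0..<n}"
  define g where "g = (\<lambda>(i, j) (x::real). if j = s i \<and> j = t i then x\<^sup>2 else if j = s i \<or> j = t i then x else 1)"
  interpret D: real_distribution D by (rule real_distribution)
  have g_cases: "g c = (\<lambda>x. x\<^sup>2) \<or> g c = (\<lambda>x. x) \<or> g c = (\<lambda>_. 1)" for c
    by (cases c; cases "snd c = s (fst c)"; cases "snd c = t (fst c)") (simp_all add: g_def)
  have g_measurable: "g c \<in> borel_measurable borel" for c
    using g_cases[of c] by (elim disjE) simp_all
  have g_integrable: "integrable D (g c)" for c
    using g_cases[of c] integrable_fst integrable_snd by (elim disjE) simp_all
  have g_integral: "(LINT x|D. g (i, j) x)
      = (if j = s i \<and> j = t i then m2 else if j = s i \<or> j = t i then m1 else 1)" for i j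
    by (cases "j = s i"; cases "j = t i")
       (simp_all add: g_def m1_def m2_def D.prob_space[simplified])
  have prod_g: "(\<Prod>c\<in>?C. g c (A \<omega> $$ c)) = (\<Prod>i = 0..<n. A \<omega> $$ (i, s i) * A \<omega> $$ (i, t i))" for \<omega>
  proof -
    have "(\<Prod>c\<in>?C. g c (A \<omega> $$ c)) = (\<Prod>i = 0..<n. \<Prod>j = 0..<n. g (i, j) (A \<omega> $$ (i, j)))"
      by (simp add: prod.cartesian_product)
    also have "\<dots> = (\<Prod>i = 0..<n. A \<omega> $$ (i, s i) * A \<omega> $$ (i, t i))"
    proof (intro prod.cong refl)
      fix i assume "i \<in> {0..<n}"
      then have st: "s i < n" "t i < n" using s t by auto
      have "(\<Prod>j = 0..<n. g (i, j) (A \<omega> $$ (i, j)))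
          = (\<Prod>j = 0..<n. (if j = s i then A \<omega> $$ (i, j) else 1) * (if j = t i then A \<omega> $$ (i, j) else 1))"
        by (intro prod.cong refl) (auto simp: g_def power2_eq_square)
      then show "(\<Prod>j = 0..<n. g (i, j) (A \<omega> $$ (i, j))) = A \<omega> $$ (i, s i) * A \<omega> $$ (i, t i)"
        using st by (simp add: prod.distrib prod.delta)
    qed
    finally show ?thesis .
  qed
  have indep: "indep_vars (\<lambda>_. borel) (\<lambda>c \<omega>. g c (A \<omega> $$ c)) ?C"
    using indep_vars_compose2[OF indep_entries, of g "\<lambda>_. borel"] g_measurable by simp
  have int: "integrable \<Omega> (\<lambda>\<omega>. g c (A \<omega> $$ c))" if "c \<in> ?C" for c
    using that integrable_entry[OF _ _ g_measurable g_integrable, of "fst c" "snd c" c] by auto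
  show "integrable \<Omega> (\<lambda>\<omega>. \<Prod>i = 0..<n. A \<omega> $$ (i, s i) * A \<omega> $$ (i, t i))"
    using indep_vars_integrable[OF _ indep int] by (simp add: prod_g)
  have "expectation (\<lambda>\<omega>. \<Prod>i = 0..<n. A \<omega> $$ (i, s i) * A \<omega> $$ (i, t i))
      = (\<Prod>c\<in>?C. expectation (\<lambda>\<omega>. g c (A \<omega> $$ c)))"
    using indep_vars_lebesgue_integral[OF _ indep int] by (simp add: prod_g)
  also have "\<dots> = (\<Prod>i = 0..<n. \<Prod>j = 0..<n. expectation (\<lambda>\<omega>. g (i, j) (A \<omega> $$ (i, j))))"
    by (simp add: prod.cartesian_product)
  also have "\<dots> = (\<Prod>i = 0..<n. \<Prod>j = 0..<n.
      if j = s i \<and> j = t i then m2 else if j = s i \<or> j = t i then m1 else 1)"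
    by (intro prod.cong refl) (simp only: expectation_entry g_measurable g_integral atLeastLessThan_iff)
  also have "\<dots> = (\<Prod>i = 0..<n. if s i = t i then m2 else m1\<^sup>2)"
  proof (intro prod.cong refl)
    fix i assume "i \<in> {0..<n}"
    then have "s i \<in> {0..<n}" "t i \<in> {0..<n}" using s t by auto
    then show "(\<Prod>j = 0..<n. if j = s i \<and> j = t i then m2 else if j = s i \<or> j = t i then m1 else 1)
        = (if s i = t i then m2 else m1\<^sup>2)"
      by (simp only: prod_two_marked finite_atLeastLessThan power2_eq_square)
  qed
  finally show "expectation (\<lambda>\<omega>. \<Prod>i = 0..<n. A \<omega> $$ (i, s i) * A \<omega> $$ (i, t i))
       = (\<Prod>i = 0..<n. if s i = t i then m2 else m1\<^sup>2)" .
qed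

lemma m1_pos: "m1 > 0"
  using mean_pos by (simp add: m1_def)

text \<open>The square expands over pairs of permutations. A row in which they agree gives
  \<open>m2\<close>, any other row \<open>m1\<^sup>2\<close>; extracting \<open>m1\<^sup>2\<close>
  from every row leaves the weight \<open>m2 / m1\<^sup>2\<close> per agreement.\<close>

lemma expectation_permanent_sq:
  "expectation (\<lambda>\<omega>. (permanent (A \<omega>))\<^sup>2)
     = m1 ^ (2*n) * (fact n)\<^sup>2 * (\<Sum>k\<le>n. (m2 / m1\<^sup>2 - 1) ^ k / fact k)"
proof -
  let ?S = "{\<sigma>. \<sigma> permutes {0..<n}}"
  have lt: "\<sigma> i < n" if "\<sigma> permutes {0..<n}" "i < n" for \<sigma> i
    using permutes_in_image[OF that(1), of i] that(2) by simp
  define X where "X \<sigma> \<tau> \<omega> = (\<Prod>i = 0..<n. A \<omega> $$ (i, \<sigma> i) * A \<omega> $$ (i, \<tau> i))"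
    for \<sigma> \<tau> :: "nat \<Rightarrow> nat" and \<omega>
  have X_integrable: "integrable \<Omega> (X \<sigma> \<tau>)" if "\<sigma> \<in> ?S" "\<tau> \<in> ?S" for \<sigma> \<tau>
    unfolding X_def using that lt by (intro integrable_prod_entries) simp_all
  have "expectation (\<lambda>\<omega>. (permanent (A \<omega>))\<^sup>2)
      = expectation (\<lambda>\<omega>. \<Sum>\<sigma>\<in>?S. \<Sum>\<tau>\<in>?S. X \<sigma> \<tau> \<omega>)"
  proof (rule Bochner_Integration.integral_cong[OF refl])
    fix \<omega> assume "\<omega> \<in> space \<Omega>"
    then have "dim_row (A \<omega>) = n" using carrier by auto
    then show "(permanent (A \<omega>))\<^sup>2 = (\<Sum>\<sigma>\<in>?S. \<Sum>\<tau>\<in>?S. X \<sigma> \<tau> \<omega>)"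
      unfolding permanent_def X_def by (simp only: power2_eq_square sum_product prod.distrib)
  qed
  also have "\<dots> = (\<Sum>\<sigma>\<in>?S. expectation (\<lambda>\<omega>. \<Sum>\<tau>\<in>?S. X \<sigma> \<tau> \<omega>))"
    by (intro Bochner_Integration.integral_sum Bochner_Integration.integrable_sum X_integrable)
  also have "\<dots> = (\<Sum>\<sigma>\<in>?S. \<Sum>\<tau>\<in>?S. expectation (X \<sigma> \<tau>))"
    by (intro sum.cong refl Bochner_Integration.integral_sum X_integrable)
  also have "\<dots> = (\<Sum>\<sigma>\<in>?S. \<Sum>\<tau>\<in>?S. \<Prod>i = 0..<n. if \<sigma> i = \<tau> i then m2 else m1\<^sup>2)"
    unfolding X_def by (intro sum.cong refl expectation_prod_entries) (simp_all add: lt)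
  also have "\<dots> = (\<Sum>\<sigma>\<in>?S. \<Sum>\<tau>\<in>?S. m1 ^ (2*n) * (\<Prod>i = 0..<n. if \<sigma> i = \<tau> i then m2 / m1\<^sup>2 else 1))"
  proof (intro sum.cong refl)
    fix \<sigma> \<tau> :: "nat \<Rightarrow> nat"
    have "(\<Prod>i = 0..<n. if \<sigma> i = \<tau> i then m2 else m1\<^sup>2)
        = (\<Prod>i = 0..<n. m1\<^sup>2 * (if \<sigma> i = \<tau> i then m2 / m1\<^sup>2 else 1))"
      using m1_pos by (intro prod.cong refl) simp
    then show "(\<Prod>i = 0..<n. if \<sigma> i = \<tau> i then m2 else m1\<^sup>2)
        = m1 ^ (2*n) * (\<Prod>i = 0..<n. if \<sigma> i = \<tau> i then m2 / m1\<^sup>2 else 1)"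
      by (simp add: prod.distrib power_mult)
  qed
  also have "\<dots> = m1 ^ (2*n) * ((fact n)\<^sup>2 * (\<Sum>k\<le>n. (m2 / m1\<^sup>2 - 1) ^ k / fact k))"
    unfolding sum_permutes_agreements[symmetric] by (simp only: sum_distrib_left)
  finally show ?thesis by (simp only: mult.assoc)
qed

text \<open>Squaring undoes the square root in the degree-2 Bethe permanent, so the second moment is
  the expectation of the lift average itself, which is linear in the products
  \<open>X \<sigma>\<close>.\<close>

lemma expectation_bethe_permanent_sq:
  "expectation (\<lambda>\<omega>. (bethe_permanent 2 (A \<omega>))\<^sup>2)
     = m1 ^ (2*n) * (fact n)\<^sup>2 * (\<Sum>k\<le>n. (m2 / m1\<^sup>2 - 1/2) ^ k / fact k
         * (pochhammer (1/2) (n - k) / fact (n - k)))"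
proof -
  let ?S = "{\<sigma>. \<sigma> permutes {0..<2*n}}"
  define c :: "(nat \<Rightarrow> nat) \<Rightarrow> real"
    where "c \<sigma> = (\<Prod>i = 0..<n. if \<sigma> (2*i) div 2 = \<sigma> (2*i+1) div 2 then 1/2 else 1/4)" for \<sigma>
  define X where "X \<sigma> \<omega> = (\<Prod>i = 0..<n. A \<omega> $$ (i, \<sigma> (2*i) div 2) * A \<omega> $$ (i, \<sigma> (2*i+1) div 2))"
    for \<sigma> :: "nat \<Rightarrow> nat" and \<omega>
  define F where "F \<omega> = (\<Sum>\<sigma>\<in>?S. c \<sigma> * X \<sigma> \<omega>)" for \<omega>
  have lt: "\<sigma> (2*i) div 2 < n" "\<sigma> (2*i+1) div 2 < n" if "\<sigma> \<in> ?S" "i < n" for \<sigma> i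
  proof -
    have "\<sigma> (2*i) \<in> {0..<2*n}" "\<sigma> (2*i+1) \<in> {0..<2*n}"
      using that permutes_in_image[of \<sigma> "{0..<2*n}"] by simp_all
    then show "\<sigma> (2*i) div 2 < n" "\<sigma> (2*i+1) div 2 < n" by auto
  qed
  have X_integrable: "integrable \<Omega> (X \<sigma>)" if "\<sigma> \<in> ?S" for \<sigma>
    unfolding X_def using lt[OF that] by (rule integrable_prod_entries)
  have F_integrable: "integrable \<Omega> F"
    unfolding F_def by (intro Bochner_Integration.integrable_sum integrable_mult_right X_integrable)
  have c_nonneg: "c \<sigma> \<ge> 0" for \<sigma> unfolding c_def by (intro prod_nonneg) auto
  have "expectation (\<lambda>\<omega>. (bethe_permanent 2 (A \<omega>))\<^sup>2) = expectation (\<lambda>\<omega>. (sqrt (F \<omega>))\<^sup>2)"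
  proof (rule Bochner_Integration.integral_cong[OF refl])
    fix \<omega> assume "\<omega> \<in> space \<Omega>"
    then have A: "A \<omega> \<in> carrier_mat n n" by (rule carrier)
    then have "dim_row (A \<omega>) = n" by auto
    then show "(bethe_permanent 2 (A \<omega>))\<^sup>2 = (sqrt (F \<omega>))\<^sup>2"
      unfolding bethe_permanent_def F_def c_def X_def
      by (simp only: average_permanent_lifted_mat[OF A] sqrt_def)
  qed
  \<comment> \<open>Non-negativity of the entries, hence of \<open>F\<close>, is known only almost
    surely, so the root is removed under the integral up to a null set.\<close>
  also have "\<dots> = expectation F"
  proof (rule integral_cong_AE)
    have "AE \<omega> in \<Omega>. F \<omega> \<ge> 0"
      using AE_entries_nonneg
    proof eventually_elim
      case (elim \<omega>)
      then have "0 \<le> X \<sigma> \<omega>" if "\<sigma> \<in> ?S" for \<sigma>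
        unfolding X_def using lt[OF that] by (intro prod_nonneg mult_nonneg_nonneg ballI) auto
      then show ?case
        unfolding F_def by (intro sum_nonneg mult_nonneg_nonneg c_nonneg)
    qed
    then show "AE \<omega> in \<Omega>. (sqrt (F \<omega>))\<^sup>2 = F \<omega>" by eventually_elim simp
  qed (use F_integrable in measurable)
  also have "\<dots> = (\<Sum>\<sigma>\<in>?S. c \<sigma> * expectation (X \<sigma>))"
    unfolding F_def using X_integrable by (subst Bochner_Integration.integral_sum) auto
  also have "\<dots> = (\<Sum>\<sigma>\<in>?S. m1 ^ (2*n) / 4 ^ n *
      (\<Prod>i = 0..<n. if \<sigma> (2*i) div 2 = \<sigma> (2*i+1) div 2 then 2 * (m2 / m1\<^sup>2) else 1))"
  proof (intro sum.cong refl)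
    fix \<sigma> assume \<sigma>: "\<sigma> \<in> ?S"
    have "expectation (X \<sigma>) = (\<Prod>i = 0..<n. if \<sigma> (2*i) div 2 = \<sigma> (2*i+1) div 2 then m2 else m1\<^sup>2)"
      unfolding X_def using lt[OF \<sigma>] by (rule expectation_prod_entries)
    \<comment> \<open>With \<open>m1\<^sup>2 / 4\<close> extracted from every row pair, a preserved
      pair, worth \<open>m2 / 2\<close>, retains \<open>2 * (m2 / m1\<^sup>2)\<close>.\<close>
    then have "c \<sigma> * expectation (X \<sigma>)
        = (\<Prod>i = 0..<n. m1\<^sup>2 / 4 * (if \<sigma> (2*i) div 2 = \<sigma> (2*i+1) div 2 then 2 * (m2 / m1\<^sup>2) else 1))"
      unfolding c_def prod.distrib[symmetric]
      using m1_pos by (auto simp: prod.distrib[symmetric] intro!: prod.cong)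
    also have "\<dots> = m1 ^ (2*n) / 4 ^ n *
      (\<Prod>i = 0..<n. if \<sigma> (2*i) div 2 = \<sigma> (2*i+1) div 2 then 2 * (m2 / m1\<^sup>2) else 1)"
      unfolding prod.distrib by (simp add: power_mult power_divide)
    finally show "c \<sigma> * expectation (X \<sigma>) = m1 ^ (2*n) / 4 ^ n *
      (\<Prod>i = 0..<n. if \<sigma> (2*i) div 2 = \<sigma> (2*i+1) div 2 then 2 * (m2 / m1\<^sup>2) else 1)" .
  qed
  also have "\<dots> = m1 ^ (2*n) / 4 ^ n * (4 ^ n * (fact n)\<^sup>2 *
      (\<Sum>k\<le>n. (m2 / m1\<^sup>2 - 1/2) ^ k / fact k * (pochhammer (1/2) (n - k) / fact (n - k))))"
    unfolding sum_permutes_preserved_pairs[symmetric] by (simp only: sum_distrib_left)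
  finally show ?thesis by simp
qed

end

section \<open>Asymptotics of the ratio\<close>

theorem theorem6:
  fixes D :: "real measure" and \<Omega> :: "nat \<Rightarrow> 'w measure" and A :: "nat \<Rightarrow> 'w \<Rightarrow> real mat"
  assumes "real_distribution D"
    and "AE x in D. 0 \<le> x"
    and "integrable D (\<lambda>x. x)"
    and "(LINT x|D. x) > 0"
    and "integrable D (\<lambda>x. x\<^sup>2)"
    and "\<And>n. n \<ge> 1 \<Longrightarrow> iid_random_matrix (\<Omega> n) D n (A n)"
  shows "(\<lambda>n. sqrt (LINT \<omega>|\<Omega> n. (permanent (A n \<omega>))\<^sup>2)
           / sqrt (LINT \<omega>|\<Omega> n. (bethe_permanent 2 (A n \<omega>))\<^sup>2)) \<sim>[at_top]
     (\<lambda>n. root 4 (pi * real n / exp 1))"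
proof -
  define r where "r = (LINT x|D. x\<^sup>2) / (LINT x|D. x)\<^sup>2"
  have "sqrt (LINT \<omega>|\<Omega> n. (permanent (A n \<omega>))\<^sup>2)
           / sqrt (LINT \<omega>|\<Omega> n. (bethe_permanent 2 (A n \<omega>))\<^sup>2)
      = sqrt ((\<Sum>k\<le>n. (r - 1) ^ k / fact k)
             / (\<Sum>k\<le>n. (r - 1/2) ^ k / fact k * (pochhammer (1/2) (n - k) / fact (n - k))))"
    if "n \<ge> 1" for n
  proof -
    have "prob_space (\<Omega> n)" using assms(6)[OF that] by (simp add: iid_random_matrix_def)
    then interpret iid_nonneg_matrix "\<Omega> n" D n "A n"
      using assms that by (simp add: iid_nonneg_matrix_def iid_nonneg_matrix_axioms_def)
    \<comment> \<open>This common factor of the two second moments cancels in the ratio.\<close>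
    have "m1 ^ (2*n) * (fact n)\<^sup>2 \<noteq> 0" using m1_pos by simp
    moreover have "r = m2 / m1\<^sup>2" by (simp add: r_def m1_def m2_def)
    ultimately show ?thesis
      unfolding expectation_permanent_sq expectation_bethe_permanent_sq real_sqrt_divide[symmetric]
      by simp
  qed
  \<comment> \<open>The random matrices are given for \<open>n \<ge> 1\<close> only; eventual
    equality suffices for asymptotic equivalence.\<close>
  then have "\<forall>\<^sub>F n in at_top. sqrt (LINT \<omega>|\<Omega> n. (permanent (A n \<omega>))\<^sup>2)
           / sqrt (LINT \<omega>|\<Omega> n. (bethe_permanent 2 (A n \<omega>))\<^sup>2)
      = sqrt ((\<Sum>k\<le>n. (r - 1) ^ k / fact k)
             / (\<Sum>k\<le>n. (r - 1/2) ^ k / fact k * (pochhammer (1/2) (n - k) / fact (n - k))))"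
    by (auto simp: eventually_at_top_linorder)
  then show ?thesis
    using sqrt_ratio_asymp_equiv[of r] by (simp add: asymp_equiv_cong[OF _ always_eventually[OF allI[OF refl]]])
qed

end
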